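(* Let $\mathcal{F}=\{f_k\}_{k=1}^m$ be a CPLIFS with attractor $\Lambda$. Suppose that whenever a breaking point $b$ of a function in $\mathcal{F}$ and a sequence $\mathbf{i}\in\Sigma$ satisfy $\Pi(\mathbf{i})=b$, the sequence $\mathbf{i}$ is periodic. Then $\Lambda$ is the attractor of a self-similar graph-directed iterated function system.
   Context: A CPLIFS (continuous piecewise linear iterated function system) is a finite list $\mathcal{F}=\{f_k:\mathbb{R}\to\mathbb{R}\}_{k=1}^m$ of continuous piecewise affine functions with finitely many pieces and all slopes in $(-1,1)\setminus\{0\}$. The breaking points of $f_k$ are the finitely many points where its slope changes. The attractor of $\mathcal{F}$ is the unique non-empty compact $\Lambda\subset\mathbb{R}$ with $\Lambda=\bigcup_{k=1}^m f_k(\Lambda)$. $\Sigma=\{1,\dots,m\}^{\mathbb{N}}$ is the symbolic space and $\Pi:\Sigma\to\Lambda$ is the natural projection, $\Pi(i_1i_2\dots)=\lim_{n\to\infty}f_{i_1}\circ\cdots\circ f_{i_n}(0)$. A sequence is periodic if it is of the form $(i_1\dots i_p)^\infty$ (infinite repetition of a finite word). Self-similar graph-directed IFS (self-similar GDIFS): a finite directed graph $\mathcal{G}=(\mathcal{V},\mathcal{E})$ with $\mathcal{V}=\{1,\dots,q\}$ (multiple edges and loops allowed), assumed strongly connected, together with a contracting similarity $F_e(x)=r_ex+t_e$ of $\mathbb{R}$, $r_e\in(-1,1)\setminus\{0\}$, for each $e\in\mathcal{E}$. Writing $\mathcal{E}_{i,j}$ for the set of edges from $i$ to $j$, there is a unique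 family of non-empty compact sets $\Lambda_1,\dots,\Lambda_q$ with $$\Lambda_i=\bigcup_{j=1}^q\bigcup_{e\in\mathcal{E}_{i,j}}F_e(\Lambda_j),\quad i=1,\dots,q.$$ The attractor of the GDIFS is $\bigcup_{i=1}^q\Lambda_i$. No separation condition is assumed. *)

theory Defs
  imports "HOL-Analysis.Analysis" "Graph_Theory.Digraph_Component"
begin

text \<open>The components of the complement of a finite set of reals are finitely many open
  intervals, the two outer ones unbounded: they carry the affine pieces.\<close>

definition cpl_contraction :: "(real \<Rightarrow> real) \<Rightarrow> bool" where
  "cpl_contraction f \<longleftrightarrow>
     continuous_on UNIV f \<and>
     (\<exists>B. finite B \<and>
        (\<forall>C\<in>components (- B). \<exists>r\<in>{-1<..<1} - {0}. \<exists>t. \<forall>x\<in>C. f x = r * x + t))"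

definition breaking_points :: "(real \<Rightarrow> real) \<Rightarrow> real set" where
  "breaking_points f =
     {b. \<exists>r s t u. r \<noteq> s \<and>
        (\<forall>\<^sub>F x in at_left b. f x = r * x + t) \<and>
        (\<forall>\<^sub>F x in at_right b. f x = s * x + u)}"

definition cplifs :: "(real \<Rightarrow> real) list \<Rightarrow> bool" where
  "cplifs fs \<longleftrightarrow> fs \<noteq> [] \<and> (\<forall>f\<in>set fs. cpl_contraction f)"

definition cplifs_attractor :: "(real \<Rightarrow> real) list \<Rightarrow> real set \<Rightarrow> bool" where
  "cplifs_attractor fs \<Lambda> \<longleftrightarrow>
     compact \<Lambda> \<and> \<Lambda> \<noteq> {} \<and> \<Lambda> = (\<Union>k<length fs. (fs ! k) ` \<Lambda>)"

text \<open>Symbols are the list positions \<open>0, \<dots>, m - 1\<close>, and sequences are indexed from \<open>0\<close>.\<close>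

definition symbolic_space :: "(real \<Rightarrow> real) list \<Rightarrow> (nat \<Rightarrow> nat) set" where
  "symbolic_space fs = {\<ii>. \<forall>n. \<ii> n < length fs}"

primrec prefix_map :: "(real \<Rightarrow> real) list \<Rightarrow> (nat \<Rightarrow> nat) \<Rightarrow> nat \<Rightarrow> real \<Rightarrow> real" where
  "prefix_map fs \<ii> 0 = id"
| "prefix_map fs \<ii> (Suc n) = prefix_map fs \<ii> n \<circ> (fs ! \<ii> n)"

definition natural_projection :: "(real \<Rightarrow> real) list \<Rightarrow> (nat \<Rightarrow> nat) \<Rightarrow> real" where
  "natural_projection fs \<ii> = lim (\<lambda>n. prefix_map fs \<ii> n 0)"

text \<open>Periodic means purely periodic, an infinite repetition of a non-empty finite word;
  eventually periodic sequences do not count.\<close>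

definition periodic_seq :: "(nat \<Rightarrow> 'a) \<Rightarrow> bool" where
  "periodic_seq \<ii> \<longleftrightarrow> (\<exists>w. w \<noteq> [] \<and> (\<forall>n. \<ii> n = w ! (n mod length w)))"

text \<open>\<open>fin_digraph\<close> admits loops and multiple edges. The similarity attached to the edge \<open>e\<close> is
  \<open>x \<mapsto> r e * x + t e\<close>.\<close>

definition self_similar_gdifs ::
  "(nat, 'e) pre_digraph \<Rightarrow> ('e \<Rightarrow> real) \<Rightarrow> ('e \<Rightarrow> real) \<Rightarrow> bool" where
  "self_similar_gdifs G r t \<longleftrightarrow>
     fin_digraph G \<and> (\<exists>q. verts G = {1..q}) \<and> strongly_connected G \<and>
     (\<forall>e\<in>arcs G. r e \<in> {-1<..<1} - {0})"

definition edges_between :: "('v, 'e) pre_digraph \<Rightarrow> 'v \<Rightarrow> 'v \<Rightarrow> 'e set" where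
  "edges_between G i j = {e \<in> arcs G. tail G e = i \<and> head G e = j}"

definition gdifs_attractor ::
  "('v, 'e) pre_digraph \<Rightarrow> ('e \<Rightarrow> real) \<Rightarrow> ('e \<Rightarrow> real) \<Rightarrow> real set \<Rightarrow> bool" where
  "gdifs_attractor G r t \<Lambda> \<longleftrightarrow>
     (\<exists>L. (\<forall>i\<in>verts G. compact (L i) \<and> L i \<noteq> {} \<and>
             L i = (\<Union>j\<in>verts G. \<Union>e\<in>edges_between G i j. (\<lambda>x. r e * x + t e) ` L j)) \<and>
          \<Lambda> = (\<Union>i\<in>verts G. L i))"

end

theory Submission
  imports Defs
begin

text \<open>
  The idea is to find an open set \<open>U\<close> that every \<open>f\<close> of the system maps into itself, that has finitely
  many components, on each of which every \<open>f\<close> is affine, and for which \<open>\<Lambda> \<inter> U\<close> is dense in \<open>\<Lambda>\<close>.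
  Given \<open>U\<close>, the vertices are the components of \<open>U\<close> that meet \<open>\<Lambda>\<close>, the compact set at \<open>C\<close> is \<open>closure (C \<inter> \<Lambda>)\<close>, and for each \<open>f\<close> and each vertex \<open>C\<close> there
  is one edge, from the component that contains \<open>f ` C\<close> to \<open>C\<close>, carrying the affine map that \<open>f\<close>
  agrees with on \<open>C\<close>. The graph is strongly connected because a small cylinder
  \<open>f\<^sub>1 (f\<^sub>2 (\<dots> \<Lambda>))\<close> around a point of \<open>C \<inter> \<Lambda>\<close> lies inside the open set \<open>C\<close>, so that the corresponding
  images of all other vertices end up in \<open>C\<close> (\<open>gdifs_of_invariant_open_set\<close>).

  For \<open>U\<close> one takes a large open interval \<open>I\<close> with \<open>f ` I \<subseteq> I\<close> and removes the set \<open>Q\<close> of all points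
  some iterated image of which, under a possibly empty composition of maps of the system, is a
  breaking point.
  Forward invariance of \<open>I - Q\<close> and affinity on its components are built into this choice. Two
  things are left to prove, and both rest on the periodicity hypothesis.

  Finiteness of \<open>Q\<close>. A breaking point \<open>b \<in> \<Lambda>\<close> has only one coding: if \<open>v\<^sup>\<infinity>\<close> and \<open>j\<close> code \<open>b\<close>, then so
  does \<open>v\<^sup>nj\<close> for every \<open>n\<close>, and the periodicity of \<open>j\<close> and of all these \<open>v\<^sup>nj\<close> forces \<open>j = v\<^sup>\<infinity>\<close>
  (\<open>coding_unique_if_codings_periodic\<close>). The points of \<open>Q \<inter> \<Lambda>\<close> are therefore coded by shifts of
  finitely many periodic sequences (\<open>finite_preorbit_in_attractor\<close>). Outside \<open>\<Lambda>\<close> every step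
  backwards multiplies the distance to \<open>\<Lambda>\<close> by at least the inverse of the contraction ratio, so
  that only finitely many steps stay in \<open>I\<close> (\<open>finite_preorbit_if_finite_in_attractor\<close>).

  Density of \<open>\<Lambda> - Q\<close> in \<open>\<Lambda>\<close>. Let \<open>x \<in> Q \<inter> \<Lambda>\<close> have the coding \<open>v\<^sup>\<infinity>\<close> and let \<open>z\<close> be another point of
  \<open>\<Lambda>\<close>. The points \<open>f\<^sub>v\<^sup>n z\<close> tend to \<open>x\<close> and differ from \<open>x\<close> because \<open>x\<close> has no second coding. Thus
  \<open>x\<close> is a limit point of \<open>\<Lambda>\<close>, and removing the finite set \<open>Q\<close> does not change this
  (\<open>preorbit_limit_point\<close>). Only when \<open>\<Lambda>\<close> is a singleton is there no such \<open>z\<close>; that case is immediate.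
\<close>

section \<open>Finite families of compact sets as graph-directed systems\<close>

text \<open>The vertices and edges of a graph-directed system may have any type: enumerating both by natural
  numbers turns them into a digraph on \<open>{1..q}\<close>.\<close>

lemma strongly_connected_family_is_gdifs:
  fixes V :: "'v set" and E :: "'e set" and src tgt :: "'e \<Rightarrow> 'v"
    and \<rho> \<tau> :: "'e \<Rightarrow> real" and L :: "'v \<Rightarrow> real set"
  assumes "finite V" "V \<noteq> {}" "finite E"
    and ends: "\<And>e. e \<in> E \<Longrightarrow> src e \<in> V \<and> tgt e \<in> V"
    and ratio: "\<And>e. e \<in> E \<Longrightarrow> \<rho> e \<in> {-1<..<1} - {0}"
    and conn: "\<And>u v. u \<in> V \<Longrightarrow> v \<in> V \<Longrightarrow> (u, v) \<in> ((\<lambda>e. (src e, tgt e)) ` E)\<^sup>*"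
    and cpt: "\<And>v. v \<in> V \<Longrightarrow> compact (L v) \<and> L v \<noteq> {}"
    and inv: "\<And>v. v \<in> V \<Longrightarrow>
                L v = (\<Union>e\<in>{e \<in> E. src e = v}. (\<lambda>x. \<rho> e * x + \<tau> e) ` L (tgt e))"
  shows "\<exists>(G :: (nat, nat) pre_digraph) r t.
           self_similar_gdifs G r t \<and> gdifs_attractor G r t (\<Union>v\<in>V. L v)"
proof -
  obtain vx where vx: "bij_betw vx {1..card V} V"
    using ex_bij_betw_nat_finite_1[OF \<open>finite V\<close>] by blast
  obtain ed where ed: "bij_betw ed {0..<card E} E"
    using ex_bij_betw_nat_finite[OF \<open>finite E\<close>] by blast
  define ix where "ix = inv_into {1..card V} vx"
  have ix: "ix v \<in> {1..card V}" "vx (ix v) = v" if "v \<in> V" for v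
    using vx that unfolding ix_def bij_betw_def by (metis inv_into_into, metis f_inv_into_f)
  have ix_vx: "ix (vx i) = i" if "i \<in> {1..card V}" for i
    using vx that unfolding ix_def by (auto simp: bij_betw_def)
  have vxV: "vx i \<in> V" if "i \<in> {1..card V}" for i
    using vx that by (auto simp: bij_betw_def)
  have edE: "ed k \<in> E" if "k \<in> {0..<card E}" for k
    using ed that by (auto simp: bij_betw_def)
  have ed_surj: "\<exists>k\<in>{0..<card E}. ed k = e" if "e \<in> E" for e
    using ed that unfolding bij_betw_def by (metis imageE)
  define G :: "(nat, nat) pre_digraph" where
    "G = \<lparr>verts = {1..card V}, arcs = {0..<card E},
          tail = (\<lambda>k. ix (src (ed k))), head = (\<lambda>k. ix (tgt (ed k)))\<rparr>"
  have sel: "verts G = {1..card V}" "arcs G = {0..<card E}"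
    "tail G k = ix (src (ed k))" "head G k = ix (tgt (ed k))" for k
    by (simp_all add: G_def)
  have fin: "fin_digraph G"
    by unfold_locales (use ix ends edE in \<open>auto simp: sel simp del: atLeastAtMost_iff\<close>)
  have reach: "reachable G i (ix w)"
    if "i \<in> {1..card V}" "(vx i, w) \<in> ((\<lambda>e. (src e, tgt e)) ` E)\<^sup>*" for i w
    using that(2)
  proof (induction rule: rtrancl_induct)
    case base
    show ?case using that(1) by (simp add: ix_vx reachable_def sel del: atLeastAtMost_iff)
  next
    case (step y z)
    then obtain e where e: "e \<in> E" "src e = y" "tgt e = z" by auto
    then obtain k where k: "k \<in> {0..<card E}" "ed k = e" using ed_surj by blast
    have "(ix y, ix z) \<in> arcs_ends G"
      using k e by (force simp: arcs_ends_def arc_to_ends_def sel)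
    moreover have "ix z \<in> verts G" using ix ends e by (auto simp: sel simp del: atLeastAtMost_iff)
    ultimately show ?case
      using step.IH unfolding reachable_def by (metis rtrancl_on_into_rtrancl_on)
  qed
  have "strongly_connected G"
    unfolding strongly_connected_def
  proof (intro conjI ballI)
    show "verts G \<noteq> {}"
      using \<open>V \<noteq> {}\<close> \<open>finite V\<close> by (auto simp: sel Suc_le_eq card_gt_0_iff)
    fix i j assume "i \<in> verts G" "j \<in> verts G"
    then show "reachable G i j"
      using reach[of i "vx j"] conn[of "vx i" "vx j"] vxV ix_vx by (auto simp: sel)
  qed
  then have gd: "self_similar_gdifs G (\<lambda>k. \<rho> (ed k)) (\<lambda>k. \<tau> (ed k))"
    using fin ratio edE unfolding self_similar_gdifs_def sel by blast
  have eqn: "L (vx i) = (\<Union>j\<in>verts G. \<Union>k\<in>edges_between G i j.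
          (\<lambda>x. \<rho> (ed k) * x + \<tau> (ed k)) ` L (vx j))" (is "_ = ?rhs")
    if i: "i \<in> verts G" for i
  proof -
    have "?rhs = (\<Union>e\<in>{e \<in> E. src e = vx i}. (\<lambda>x. \<rho> e * x + \<tau> e) ` L (tgt e))" (is "_ = ?mid")
    proof (intro equalityI subsetI)
      fix y assume "y \<in> ?rhs"
      then obtain j k where k: "k \<in> {0..<card E}" "ix (src (ed k)) = i" "ix (tgt (ed k)) = j"
        "y \<in> (\<lambda>x. \<rho> (ed k) * x + \<tau> (ed k)) ` L (vx j)"
        unfolding edges_between_def sel by blast
      have "ed k \<in> E" by (rule edE[OF k(1)])
      then have "src (ed k) = vx i" "tgt (ed k) = vx j"
        using ix(2) ends k(2,3) by metis+
      then show "y \<in> ?mid" using k(4) \<open>ed k \<in> E\<close>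
        by (intro UN_I[of "ed k"]) simp_all
    next
      fix y assume "y \<in> ?mid"
      then obtain e where e: "e \<in> E" "src e = vx i" "y \<in> (\<lambda>x. \<rho> e * x + \<tau> e) ` L (tgt e)"
        by blast
      obtain k where k: "k \<in> {0..<card E}" "ed k = e" using ed_surj e by blast
      have "k \<in> edges_between G i (ix (tgt e))"
        using k e i ix_vx by (simp add: edges_between_def sel del: atLeastAtMost_iff)
      moreover have "ix (tgt e) \<in> verts G" "vx (ix (tgt e)) = tgt e"
        using ix ends e by (auto simp: sel simp del: atLeastAtMost_iff)
      ultimately show "y \<in> ?rhs" using e(3) k(2)
        by (intro UN_I[of "ix (tgt e)"] UN_I[of k]) simp_all
    qed
    then show ?thesis using inv[of "vx i"] vxV i by (simp add: sel del: atLeastAtMost_iff)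
  qed
  have un: "(\<Union>v\<in>V. L v) = (\<Union>i\<in>verts G. L (vx i))"
  proof -
    have "vx ` verts G = V" using bij_betw_imp_surj_on[OF vx] by (simp only: sel)
    then have "L ` V = (\<lambda>i. L (vx i)) ` verts G" by (metis image_image)
    then show ?thesis by (simp only:)
  qed
  have ne: "compact (L (vx i)) \<and> L (vx i) \<noteq> {}" if "i \<in> verts G" for i
    using cpt[OF vxV[of i]] that[unfolded sel] by blast
  have "gdifs_attractor G (\<lambda>k. \<rho> (ed k)) (\<lambda>k. \<tau> (ed k)) (\<Union>v\<in>V. L v)"
    unfolding gdifs_attractor_def
    by (rule exI[of _ "\<lambda>i. L (vx i)"], intro conjI ballI)
      (rule ne[THEN conjunct1] ne[THEN conjunct2] eqn un, assumption?)+
  with gd show ?thesis by blast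
qed

section \<open>Graph-directed systems from forward invariant open sets\<close>

text \<open>Taking the closure of \<open>C \<inter> \<Lambda>\<close>, instead of \<open>\<Lambda>\<close> intersected with \<open>closure C\<close>, matters at a boundary
  point \<open>p \<in> \<Lambda>\<close> of \<open>C\<close>: such a point may be isolated in \<open>\<Lambda>\<close> from the side of \<open>C\<close>, and then no edge need
  produce it. With the closure it suffices to cover the points of \<open>C \<inter> \<Lambda>\<close>, since a finite union of
  compact sets is closed. A point of \<open>C\<close> determines the vertex \<open>C\<close>, so that whenever an image
  \<open>f ` K C'\<close> hits \<open>C\<close>, it belongs to an edge that leaves \<open>C\<close>.\<close>

lemma gdifs_of_invariant_open_set:
  fixes F :: "(real \<Rightarrow> real) set" and \<Lambda> U :: "real set"
  assumes "finite F"
    and lip: "\<And>f x y. f \<in> F \<Longrightarrow> dist (f x) (f y) \<le> c * dist x y"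
    and c: "0 \<le> c" "c < 1"
    and "compact \<Lambda>" "\<Lambda> \<noteq> {}" and attr: "\<Lambda> = (\<Union>f\<in>F. f ` \<Lambda>)"
    and "open U" and inv: "\<And>f. f \<in> F \<Longrightarrow> f ` U \<subseteq> U"
    and finU: "finite (components U)"
    and affine: "\<And>f C. f \<in> F \<Longrightarrow> C \<in> components U \<Longrightarrow>
                   \<exists>r\<in>{-1<..<1} - {0}. \<exists>t. \<forall>x\<in>C. f x = r * x + t"
    and dense: "\<Lambda> \<subseteq> closure (\<Lambda> \<inter> U)"
  shows "\<exists>(G :: (nat, nat) pre_digraph) r t.
           self_similar_gdifs G r t \<and> gdifs_attractor G r t \<Lambda>"
proof -
  define V where "V = {C \<in> components U. C \<inter> \<Lambda> \<noteq> {}}"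
  define K where "K C = closure (C \<inter> \<Lambda>)" for C
  have VD: "C \<in> components U" "C \<inter> \<Lambda> \<noteq> {}" "open C" if "C \<in> V" for C
    using that \<open>open U\<close> open_components unfolding V_def by auto
  have finV: "finite V" using finU by (simp add: V_def)
  have KL: "K C \<subseteq> \<Lambda>" for C
    unfolding K_def using \<open>compact \<Lambda>\<close> by (simp add: closure_minimal compact_imp_closed)
  have cptK: "compact (K C)" for C
    unfolding K_def using \<open>compact \<Lambda>\<close> by (meson bounded_Int compact_closure compact_imp_bounded)
  have cont: "continuous_on S f" if "f \<in> F" for f S
  proof (rule continuous_on_subset)
    have "c-lipschitz_on UNIV f" using lip[OF that] c by (intro lipschitz_onI) auto
    then show "continuous_on UNIV f" by (rule lipschitz_on_continuous_on)
  qed simp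
  have coverU: "\<exists>C\<in>V. x \<in> C" if "x \<in> \<Lambda> \<inter> U" for x
  proof -
    have "x \<in> connected_component_set U x" "connected_component_set U x \<in> components U"
      using that by (auto simp: componentsI)
    then show ?thesis using that unfolding V_def by blast
  qed
  have cover: "\<Lambda> = (\<Union>C\<in>V. K C)"
  proof
    have "\<Lambda> \<inter> U \<subseteq> (\<Union>C\<in>V. K C)"
    proof
      fix x assume x: "x \<in> \<Lambda> \<inter> U"
      then obtain C where "C \<in> V" "x \<in> C" using coverU by blast
      then have "x \<in> K C" using x unfolding K_def by (intro closure_subset[THEN subsetD]) auto
      then show "x \<in> (\<Union>C\<in>V. K C)" using \<open>C \<in> V\<close> by blast
    qed
    moreover have "closed (\<Union>C\<in>V. K C)"
      using finV by (auto simp: K_def)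
    ultimately show "\<Lambda> \<subseteq> (\<Union>C\<in>V. K C)"
      using dense closure_minimal by blast
  qed (use KL in blast)
  have disj: "C = C'" if "C \<in> V" "C' \<in> V" "x \<in> C" "x \<in> K C'" for C C' x
  proof -
    have "C \<inter> C' \<noteq> {}"
      using VD(3)[OF that(1)] that(3,4) unfolding K_def
      by (metis closure_iff_nhds_not_empty disjoint_iff inf.cobounded1 subset_eq)
    then show ?thesis using components_eq[of C U C'] VD that by blast
  qed
  have "\<exists>D\<in>V. f ` C \<subseteq> D" if f: "f \<in> F" and C: "C \<in> V" for f C
  proof -
    have "C \<subseteq> U" "topological_space_class.connected C" "U \<noteq> {}"
      using VD[OF C] in_components_subset in_components_connected by blast+
    then have "topological_space_class.connected (f ` C)" "f ` C \<subseteq> U"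
      using cont[OF f] inv[OF f] connected_continuous_image by blast+
    then obtain D where D: "D \<in> components U" "f ` C \<subseteq> D"
      using exists_component_superset \<open>U \<noteq> {}\<close> by metis
    obtain x where "x \<in> C" "x \<in> \<Lambda>" using VD[OF C] by blast
    then have "f x \<in> D \<inter> \<Lambda>" using D attr f by blast
    then show ?thesis using D unfolding V_def by blast
  qed
  then obtain D where D: "\<And>f C. f \<in> F \<Longrightarrow> C \<in> V \<Longrightarrow> D f C \<in> V"
    "\<And>f C. f \<in> F \<Longrightarrow> C \<in> V \<Longrightarrow> f ` C \<subseteq> D f C" by metis
  obtain r t where rt: "\<And>f C. f \<in> F \<Longrightarrow> C \<in> V \<Longrightarrow> r f C \<in> {-1<..<1} - {0}"
    "\<And>f C x. f \<in> F \<Longrightarrow> C \<in> V \<Longrightarrow> x \<in> C \<Longrightarrow> f x = r f C * x + t f C"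
    using affine VD(1) by metis
  have rtK: "f x = r f C * x + t f C" if "f \<in> F" "C \<in> V" "x \<in> K C" for f C x
  proof -
    have "x \<in> closure C" using that(3) unfolding K_def by (meson Int_lower1 closure_mono subsetD)
    moreover have "continuous_on (closure C) (\<lambda>x. f x - (r f C * x + t f C))"
      by (intro continuous_intros cont that)
    ultimately show ?thesis
      using continuous_constant_on_closure[of C "\<lambda>x. f x - (r f C * x + t f C)" 0 x] rt(2) that
      by auto
  qed
  have fK: "f ` K C \<subseteq> K (D f C)" if f: "f \<in> F" and C: "C \<in> V" for f C
    unfolding K_def
  proof (rule image_closure_subset[OF cont[OF f]])
    have "f ` (C \<inter> \<Lambda>) \<subseteq> D f C \<inter> \<Lambda>" using D(2)[OF f C] attr f by blast
    then show "f ` (C \<inter> \<Lambda>) \<subseteq> closure (D f C \<inter> \<Lambda>)" using closure_subset by blast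
  qed simp
  define ends where "ends = (\<lambda>e. (D (fst e) (snd e), snd e)) ` (F \<times> V)"
  obtain M where M: "\<And>x y. x \<in> \<Lambda> \<Longrightarrow> y \<in> \<Lambda> \<Longrightarrow> dist x y \<le> M"
    using \<open>compact \<Lambda>\<close> compact_imp_bounded bounded_two_points by metis
  \<comment> \<open>The backward itinerary of \<open>x\<close> of length \<open>n\<close>, started at \<open>C'\<close>, leads to a component that comes
    \<open>c ^ n * M\<close>-close to \<open>x\<close>. As the component of \<open>x\<close> is open, it is that component once \<open>n\<close> is large.\<close>
  have approach: "\<exists>C\<in>V. (C, C') \<in> ends\<^sup>* \<and> (\<exists>y\<in>C \<inter> \<Lambda>. dist x y \<le> c ^ n * M)"
    if C': "C' \<in> V" and "x \<in> \<Lambda>" for C' x n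
    using \<open>x \<in> \<Lambda>\<close>
  proof (induction n arbitrary: x)
    case 0
    then show ?case using C' VD(2)[OF C'] M by fastforce
  next
    case (Suc n)
    then obtain f x' where f: "f \<in> F" "x' \<in> \<Lambda>" "x = f x'" using attr by blast
    obtain C y where C: "C \<in> V" "(C, C') \<in> ends\<^sup>*" "y \<in> C \<inter> \<Lambda>" "dist x' y \<le> c ^ n * M"
      using Suc.IH[OF f(2)] by blast
    have "(D f C, C) \<in> ends" using f C unfolding ends_def by force
    then have "(D f C, C') \<in> ends\<^sup>*" using C(2) by simp
    moreover have "f y \<in> D f C \<inter> \<Lambda>" using D(2)[OF f(1) C(1)] attr f C by blast
    moreover have "dist x (f y) \<le> c ^ Suc n * M"
      using lip[OF f(1), of x' y] mult_left_mono[OF C(4) c(1)] f(3) by (simp add: mult.assoc)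
    ultimately show ?case using D(1)[OF f(1) C(1)] by blast
  qed
  have conn: "(C, C') \<in> ends\<^sup>*" if C: "C \<in> V" and C': "C' \<in> V" for C C'
  proof -
    obtain x where x: "x \<in> C" "x \<in> \<Lambda>" using VD[OF C] by blast
    obtain e where e: "e > 0" "ball x e \<subseteq> C" using VD(3)[OF C] x open_contains_ball by blast
    have "(\<lambda>n. c ^ n * M) \<longlonglongrightarrow> 0"
      using c by (intro tendsto_mult_left_zero LIMSEQ_realpow_zero)
    then have "eventually (\<lambda>n. c ^ n * M < e) sequentially"
      using e(1) by (rule order_tendstoD)
    then obtain n where n: "c ^ n * M < e" by (auto simp: eventually_sequentially)
    obtain C1 y where C1: "C1 \<in> V" "(C1, C') \<in> ends\<^sup>*" "y \<in> C1" "dist x y \<le> c ^ n * M"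
      using approach[OF C' x(2)] by blast
    then have "y \<in> C" using n e by (auto simp: subset_eq)
    then have "C = C1" using components_eq[of C U C1] VD C C1 by blast
    then show ?thesis using C1 by simp
  qed
  have KE: "K C = (\<Union>e\<in>{e \<in> F \<times> V. D (fst e) (snd e) = C}.
              (\<lambda>x. r (fst e) (snd e) * x + t (fst e) (snd e)) ` K (snd e))" (is "_ = ?rhs")
    if C: "C \<in> V" for C
  proof
    have "closed (\<Union>e\<in>{e \<in> F \<times> V. D (fst e) (snd e) = C}.
              (\<lambda>x. r (fst e) (snd e) * x + t (fst e) (snd e)) ` K (snd e))"
    proof (intro closed_UN ballI)
      show "finite {e \<in> F \<times> V. D (fst e) (snd e) = C}" using \<open>finite F\<close> finV by simp
      show "closed ((\<lambda>x. r (fst e) (snd e) * x + t (fst e) (snd e)) ` K (snd e))" for e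
        by (intro compact_imp_closed compact_continuous_image cptK continuous_intros)
    qed
    moreover have "C \<inter> \<Lambda> \<subseteq> ?rhs"
    proof
      fix x assume x: "x \<in> C \<inter> \<Lambda>"
      then obtain f y where f: "f \<in> F" "y \<in> \<Lambda>" "x = f y" using attr by blast
      then obtain C' where C': "C' \<in> V" "y \<in> K C'" using cover by blast
      then have "x \<in> K (D f C')" using fK f by blast
      then have "D f C' = C" using disj[OF C] D(1) f C' x by blast
      then show "x \<in> ?rhs"
        using f C' rtK[OF f(1) C'] by (intro UN_I[of "(f, C')"]) auto
    qed
    ultimately have "closure (C \<inter> \<Lambda>) \<subseteq> ?rhs" by (intro closure_minimal)
    then show "K C \<subseteq> ?rhs" by (simp only: K_def[of C])
    show "?rhs \<subseteq> K C"
    proof (intro UN_least image_subsetI)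
      fix e x assume "e \<in> {e \<in> F \<times> V. D (fst e) (snd e) = C}" "x \<in> K (snd e)"
      then obtain f C' where e: "e = (f, C')" "f \<in> F" "C' \<in> V" "D f C' = C" "x \<in> K C'"
        by auto
      then have "f x \<in> K C" using fK by blast
      then show "r (fst e) (snd e) * x + t (fst e) (snd e) \<in> K C"
        using rtK e by simp
    qed
  qed
  show ?thesis
  proof (subst cover, rule strongly_connected_family_is_gdifs)
    show "finite V" by fact
    show "V \<noteq> {}" using cover \<open>\<Lambda> \<noteq> {}\<close> by blast
    show "finite (F \<times> V)" using \<open>finite F\<close> finV by simp
    show "\<And>e. e \<in> F \<times> V \<Longrightarrow> D (fst e) (snd e) \<in> V \<and> snd e \<in> V"
      using D(1) by auto
    show "\<And>e. e \<in> F \<times> V \<Longrightarrow> r (fst e) (snd e) \<in> {-1<..<1} - {0}"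
      using rt(1) by auto
    show "\<And>u v. u \<in> V \<Longrightarrow> v \<in> V \<Longrightarrow>
        (u, v) \<in> ((\<lambda>e. (D (fst e) (snd e), snd e)) ` (F \<times> V))\<^sup>*"
      using conn unfolding ends_def .
    show "\<And>v. v \<in> V \<Longrightarrow> compact (K v) \<and> K v \<noteq> {}"
      using cptK VD(2) by (auto simp: K_def)
  qed (rule KE)
qed

section \<open>Continuous piecewise linear contractions\<close>

text \<open>The component of a point is determined by the set of those points of \<open>B\<close> that lie below it.\<close>

lemma finite_components_Diff_finite:
  fixes I B :: "real set"
  assumes "convex I" "finite B"
  shows "finite (components (I - B))"
proof -
  define comp where "comp = connected_component_set (I - B)"
  define below where "below x = B \<inter> {..x}" for x
  have same: "comp x = comp y" if "x \<in> I - B" "y \<in> I - B" "below x = below y" for x y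
  proof -
    have "closed_segment x y \<subseteq> I - B"
    proof
      fix z assume z: "z \<in> closed_segment x y"
      then have "z \<in> I" using assms(1) that convex_contains_segment by blast
      moreover have "z \<notin> B"
      proof
        assume "z \<in> B"
        then have "z \<le> x \<longleftrightarrow> z \<le> y" using that(3) unfolding below_def by blast
        then have "z = x \<or> z = y"
          using z by (auto simp: closed_segment_eq_real_ivl split: if_splits)
        then show False using \<open>z \<in> B\<close> that by blast
      qed
      ultimately show "z \<in> I - B" by blast
    qed
    then have "connected_component (I - B) x y"
      unfolding connected_component_def using connected_segment by blast
    then show ?thesis unfolding comp_def by (rule connected_component_eq[OF CollectI, symmetric])
  qed
  have "comp ` (I - B) \<subseteq> (\<lambda>s. comp (SOME x. x \<in> I - B \<and> below x = s)) ` (below ` (I - B))"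
  proof
    fix C assume "C \<in> comp ` (I - B)"
    then obtain x where x: "x \<in> I - B" "C = comp x" by blast
    define y where "y = (SOME y. y \<in> I - B \<and> below y = below x)"
    have "y \<in> I - B \<and> below y = below x" unfolding y_def using x(1) by (metis (mono_tags, lifting) someI)
    then have "C = comp y" using same x by blast
    then show "C \<in> (\<lambda>s. comp (SOME x. x \<in> I - B \<and> below x = s)) ` (below ` (I - B))"
      unfolding y_def using x(1) by blast
  qed
  moreover have "finite (below ` (I - B))"
    by (rule finite_subset[of _ "Pow B"]) (use assms in \<open>auto simp: below_def\<close>)
  ultimately have "finite (comp ` (I - B))" by (meson finite_imageI finite_subset)
  moreover have "components (I - B) = comp ` (I - B)" by (simp add: components_def comp_def)
  ultimately show ?thesis by simp
qed

lemma affine_on_piece: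
  fixes f :: "real \<Rightarrow> real"
  assumes "\<forall>C\<in>components (- B). \<exists>r\<in>{-1<..<1} - {0}. \<exists>t. \<forall>x\<in>C. f x = r * x + t"
    and "topological_space_class.connected S" "S \<noteq> {}" "S \<inter> B = {}"
  shows "\<exists>r\<in>{-1<..<1} - {0}. \<exists>t. \<forall>x\<in>S. f x = r * x + t"
proof -
  have "S \<subseteq> - B" "- B \<noteq> {}" using assms by blast+
  then obtain C where "C \<in> components (- B)" "S \<subseteq> C"
    using exists_component_superset assms(2) by metis
  then show ?thesis using assms(1) by (metis subsetD)
qed

text \<open>Continuity at \<open>b\<close> fixes the constant terms: both one-sided pieces pass through \<open>(b, f b)\<close>.\<close>

lemma cpl_contraction_one_sided_slopes:
  assumes "cpl_contraction f"
  obtains \<delta> r s where "\<delta> > 0" "r \<in> {-1<..<1} - {0}" "s \<in> {-1<..<1} - {0}"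
    "\<And>x. x \<in> {b - \<delta><..b} \<Longrightarrow> f x = f b + r * (x - b)"
    "\<And>x. x \<in> {b..<b + \<delta>} \<Longrightarrow> f x = f b + s * (x - b)"
proof -
  obtain B where B: "finite B"
    "\<forall>C\<in>components (- B). \<exists>r\<in>{-1<..<1} - {0}. \<exists>t. \<forall>x\<in>C. f x = r * x + t"
    and cont: "continuous_on UNIV f"
    using assms unfolding cpl_contraction_def by blast
  obtain \<delta> where \<delta>: "\<delta> > 0" "\<And>x. x \<in> B \<Longrightarrow> x \<noteq> b \<Longrightarrow> \<delta> \<le> dist b x"
    using finite_set_avoid[OF B(1), of b] by blast
  have side: "\<exists>r\<in>{-1<..<1} - {0}. \<forall>x\<in>closure S. f x = f b + r * (x - b)"
    if S: "topological_space_class.connected S" "S \<noteq> {}" "S \<inter> B = {}" "b \<in> closure S" for S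
  proof -
    obtain r t where r: "r \<in> {-1<..<1} - {0}" "\<And>x. x \<in> S \<Longrightarrow> f x = r * x + t"
      using affine_on_piece[OF B(2) S(1-3)] by blast
    have "continuous_on (closure S) (\<lambda>x. f x - (r * x + t))"
      by (intro continuous_intros continuous_on_subset[OF cont]) simp
    then have "f x = r * x + t" if "x \<in> closure S" for x
      using continuous_constant_on_closure[of S "\<lambda>x. f x - (r * x + t)" 0 x] r(2) that by auto
    then show ?thesis using r(1) S(4) by (intro bexI[of _ r]) (auto simp: algebra_simps)
  qed
  obtain r where r: "r \<in> {-1<..<1} - {0}" "\<And>x. x \<in> {b - \<delta>..b} \<Longrightarrow> f x = f b + r * (x - b)"
  proof -
    have "{b - \<delta><..<b} \<inter> B = {}"
      using \<delta>(2) by (fastforce simp: dist_real_def)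
    then have "\<exists>q\<in>{-1<..<1} - {0}. \<forall>x\<in>closure {b - \<delta><..<b}. f x = f b + q * (x - b)"
      using \<delta>(1) by (intro side) simp_all
    then obtain q where q: "q \<in> {-1<..<1} - {0}"
      "\<forall>x\<in>closure {b - \<delta><..<b}. f x = f b + q * (x - b)" by (rule bexE)
    moreover have "closure {b - \<delta><..<b} = {b - \<delta>..b}" using \<delta>(1) by simp
    ultimately show ?thesis using that[of q] by (simp only:)
  qed
  obtain s where s: "s \<in> {-1<..<1} - {0}" "\<And>x. x \<in> {b..b + \<delta>} \<Longrightarrow> f x = f b + s * (x - b)"
  proof -
    have "{b<..<b + \<delta>} \<inter> B = {}"
      using \<delta>(2) by (fastforce simp: dist_real_def)
    then have "\<exists>q\<in>{-1<..<1} - {0}. \<forall>x\<in>closure {b<..<b + \<delta>}. f x = f b + q * (x - b)"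
      using \<delta>(1) by (intro side) simp_all
    then obtain q where q: "q \<in> {-1<..<1} - {0}"
      "\<forall>x\<in>closure {b<..<b + \<delta>}. f x = f b + q * (x - b)" by (rule bexE)
    moreover have "closure {b<..<b + \<delta>} = {b..b + \<delta>}" using \<delta>(1) by simp
    ultimately show ?thesis using that[of q] by (simp only:)
  qed
  show ?thesis
  proof (rule that[OF \<delta>(1) r(1) s(1)])
    show "f x = f b + r * (x - b)" if "x \<in> {b - \<delta><..b}" for x
      using that by (intro r(2)) simp
    show "f x = f b + s * (x - b)" if "x \<in> {b..<b + \<delta>}" for x
      using that by (intro s(2)) simp
  qed
qed

text \<open>The finite set in the definition of a piecewise linear contraction may contain points at which the
  slope does not change. Here these are discarded: only a genuine breaking point obstructs affinity.\<close>

lemma cpl_contraction_affine_near: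
  assumes "cpl_contraction f" "b \<notin> breaking_points f"
  shows "\<exists>r\<in>{-1<..<1} - {0}. \<exists>t. \<forall>\<^sub>F x in nhds b. f x = r * x + t"
proof -
  obtain \<delta> r s where \<delta>: "\<delta> > 0" "r \<in> {-1<..<1} - {0}" "s \<in> {-1<..<1} - {0}"
    and l: "\<And>x. x \<in> {b - \<delta><..b} \<Longrightarrow> f x = f b + r * (x - b)"
    and u: "\<And>x. x \<in> {b..<b + \<delta>} \<Longrightarrow> f x = f b + s * (x - b)"
    using cpl_contraction_one_sided_slopes[OF assms(1), of b] by blast
  have "\<forall>\<^sub>F x in at_left b. f x = r * x + (f b - r * b)"
    using l \<delta>(1) unfolding eventually_at_left_field
    by (intro exI[of _ "b - \<delta>"]) (auto simp: algebra_simps)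
  moreover have "\<forall>\<^sub>F x in at_right b. f x = s * x + (f b - s * b)"
    using u \<delta>(1) unfolding eventually_at_right_field
    by (intro exI[of _ "b + \<delta>"]) (auto simp: algebra_simps)
  ultimately have "r = s" using assms(2) unfolding breaking_points_def by blast
  define t where "t = f b - r * b"
  have "f x = r * x + t" if "x \<in> {b - \<delta><..<b + \<delta>}" for x
    using l[of x] u[of x] that \<open>r = s\<close> unfolding t_def
    by (cases "x \<le> b") (auto simp: algebra_simps)
  then have "\<forall>x\<in>{b - \<delta><..<b + \<delta>}. f x = r * x + t" by blast
  then have "\<forall>\<^sub>F x in nhds b. f x = r * x + t"
    unfolding eventually_nhds using \<delta>(1)
    by (intro exI[of _ "{b - \<delta><..<b + \<delta>}"]) simp
  then show ?thesis using \<delta>(2) by blast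
qed

text \<open>A one-sided slope is the limit of the difference quotients along that side, hence the derivative.\<close>

lemma affine_near_not_breaking_point:
  assumes "\<forall>\<^sub>F x in nhds b. f x = r * x + t"
  shows "b \<notin> breaking_points f"
proof
  have slope: "r = s"
    if "F \<noteq> bot" "F \<le> at b" "\<forall>\<^sub>F x in F. f x = s * x + u" for s u and F :: "real filter"
  proof -
    have "(f has_field_derivative r) (at b)"
    proof -
      have "((\<lambda>x. r * x + t) has_field_derivative r) (at b)" by (auto intro!: derivative_eq_intros)
      then show ?thesis using DERIV_cong_ev[OF refl assms refl] by blast
    qed
    then have "((\<lambda>x. (f x - f b) / (x - b)) \<longlongrightarrow> r) F"
      using that(2) unfolding has_field_derivative_iff by (meson tendsto_mono)
    have "(f \<longlongrightarrow> f b) (at b)"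
      using \<open>(f has_field_derivative r) (at b)\<close> DERIV_isCont isCont_def by blast
    then have fF: "(f \<longlongrightarrow> f b) F" using that(2) by (rule tendsto_mono[rotated])
    have idF: "((\<lambda>x. x) \<longlongrightarrow> b) F" using that(2) by (rule tendsto_mono) simp
    have "((\<lambda>x. s * x + u) \<longlongrightarrow> s * b + u) F" by (intro tendsto_intros idF)
    then have "(f \<longlongrightarrow> s * b + u) F"
      using that(3) by (simp add: filterlim_cong[OF refl refl that(3)])
    then have fb: "f b = s * b + u" using fF that(1) tendsto_unique by blast
    have "\<forall>\<^sub>F x in F. x \<noteq> b"
      using that(2) by (auto simp: eventually_at_filter le_filter_def)
    then have "\<forall>\<^sub>F x in F. s = (f x - f b) / (x - b)"
      using that(3) by eventually_elim (simp add: fb field_simps)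
    then have "((\<lambda>x. s) \<longlongrightarrow> r) F"
      using \<open>((\<lambda>x. (f x - f b) / (x - b)) \<longlongrightarrow> r) F\<close> by (simp add: filterlim_cong[OF refl refl])
    then show ?thesis using that(1) by (simp add: tendsto_const_iff)
  qed
  assume "b \<in> breaking_points f"
  then obtain r' s' t' u where "r' \<noteq> s'" "\<forall>\<^sub>F x in at_left b. f x = r' * x + t'"
    "\<forall>\<^sub>F x in at_right b. f x = s' * x + u" unfolding breaking_points_def by blast
  then show False using slope[of "at_left b"] slope[of "at_right b"]
    by (simp add: at_le)
qed

lemma finite_breaking_points:
  assumes "cpl_contraction f"
  shows "finite (breaking_points f)"
proof -
  obtain B where B: "finite B"
    "\<forall>C\<in>components (- B). \<exists>r\<in>{-1<..<1} - {0}. \<exists>t. \<forall>x\<in>C. f x = r * x + t"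
    using assms unfolding cpl_contraction_def by blast
  have "b \<notin> breaking_points f" if "b \<notin> B" for b
  proof -
    have "open (- B)" using B(1) by (simp add: finite_imp_closed open_Compl)
    then have "\<exists>e>0. ball b e \<subseteq> - B" using that open_contains_ball[of "- B"] by simp
    then obtain e where e: "e > 0" "ball b e \<subseteq> - B" by blast
    have "\<exists>r\<in>{-1<..<1} - {0}. \<exists>t. \<forall>x\<in>ball b e. f x = r * x + t"
      using e by (intro affine_on_piece[OF B(2)]) (simp_all add: disjoint_eq_subset_Compl)
    then obtain r t where "\<forall>x\<in>ball b e. f x = r * x + t" by blast
    then have "\<forall>\<^sub>F x in nhds b. f x = r * x + t"
      using e(1) unfolding eventually_nhds by (intro exI[of _ "ball b e"]) auto
    then show ?thesis by (rule affine_near_not_breaking_point)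
  qed
  then show ?thesis using B(1) by (meson finite_subset subsetI)
qed

text \<open>The coefficients of the local affine expression are locally constant, hence constant on a
  connected set.\<close>

lemma cpl_contraction_affine_on:
  assumes "cpl_contraction f"
    and "topological_space_class.connected S" "S \<noteq> {}" "S \<inter> breaking_points f = {}"
  shows "\<exists>r\<in>{-1<..<1} - {0}. \<exists>t. \<forall>x\<in>S. f x = r * x + t"
proof -
  \<comment> \<open>Slope and intercept of the affine germ of \<open>f\<close> at \<open>x\<close>, as a function of \<open>x\<close> alone.\<close>
  define coeffs where "coeffs x = (deriv f x, f x - deriv f x * x)" for x
  have coeffs: "coeffs x = (r, t)" if "\<forall>\<^sub>F y in nhds x. f y = r * y + t" for x r t
  proof -
    have "deriv f x = deriv (\<lambda>y. r * y + t) x" using that by (rule deriv_cong_ev) simp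
    also have "\<dots> = r" by (rule DERIV_imp_deriv) (auto intro!: derivative_eq_intros)
    finally show ?thesis
      using eventually_nhds_x_imp_x[OF that] by (simp add: coeffs_def)
  qed
  obtain a where "a \<in> S" using assms(3) by blast
  obtain r t where rt: "r \<in> {-1<..<1} - {0}" "\<forall>\<^sub>F y in nhds a. f y = r * y + t"
    using cpl_contraction_affine_near[OF assms(1)] assms(4) \<open>a \<in> S\<close> by blast
  have const: "coeffs x = coeffs a" if "x \<in> S" for x
  proof (rule connected_local_const[OF assms(2) that \<open>a \<in> S\<close>], intro ballI)
    fix z assume "z \<in> S"
    then obtain r' t' where near: "\<forall>\<^sub>F y in nhds z. f y = r' * y + t'"
      using cpl_contraction_affine_near[OF assms(1)] assms(4) by blast
    then have "\<forall>\<^sub>F y in nhds z. \<forall>\<^sub>F y' in nhds y. f y' = r' * y' + t'"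
      by (simp add: eventually_eventually)
    then have "\<forall>\<^sub>F y in nhds z. coeffs z = coeffs y"
      by eventually_elim (simp add: coeffs coeffs[OF near])
    then show "\<forall>\<^sub>F y in at z within S. coeffs z = coeffs y"
      by (simp add: eventually_at_filter eventually_mono)
  qed
  have "f x = r * x + t" if "x \<in> S" for x
  proof -
    have "coeffs x = (r, t)" using const[OF that] coeffs[OF rt(2)] by simp
    then have d: "deriv f x = r" and "f x - deriv f x * x = t" by (auto simp: coeffs_def)
    from this(2) have "f x - r * x = t" unfolding d .
    then show ?thesis by linarith
  qed
  then show ?thesis using rt(1) by blast
qed

lemma cpl_contraction_finite_fibre:
  assumes "cpl_contraction f"
  shows "finite (f -` {q})"
proof -
  let ?B = "breaking_points f"
  have fin: "finite ?B" by (rule finite_breaking_points[OF assms])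
  have "finite (f -` {q} \<inter> C)" if C: "C \<in> components (UNIV - ?B)" for C
  proof -
    have "C \<noteq> {}" "topological_space_class.connected C" "C \<inter> ?B = {}"
      using C in_components_nonempty in_components_connected in_components_subset by blast+
    then obtain r t where rt: "r \<noteq> 0" "\<forall>x\<in>C. f x = r * x + t"
      using cpl_contraction_affine_on[OF assms] by blast
    have "f -` {q} \<inter> C \<subseteq> {(q - t) / r}" using rt by (auto simp: field_simps)
    then show ?thesis by (rule finite_subset) simp
  qed
  moreover have "finite (components (UNIV - ?B))"
    by (rule finite_components_Diff_finite) (simp_all add: fin)
  ultimately have "finite (?B \<union> (\<Union>C\<in>components (UNIV - ?B). f -` {q} \<inter> C))"
    using fin by blast
  moreover have "f -` {q} \<subseteq> ?B \<union> (\<Union>C\<in>components (UNIV - ?B). f -` {q} \<inter> C)"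
  proof
    fix x assume "x \<in> f -` {q}"
    moreover have "x \<in> ?B \<or> x \<in> connected_component_set (UNIV - ?B) x \<and>
        connected_component_set (UNIV - ?B) x \<in> components (UNIV - ?B)"
      by (auto simp: componentsI)
    ultimately show "x \<in> ?B \<union> (\<Union>C\<in>components (UNIV - ?B). f -` {q} \<inter> C)" by blast
  qed
  ultimately show ?thesis by (rule finite_subset[rotated])
qed

text \<open>The fundamental theorem of calculus with finitely many exceptional points yields
  \<open>f y - f x\<close> as the integral of the slope, which is bounded by the largest modulus of the finitely
  many slopes.\<close>

lemma cpl_contraction_lipschitz:
  assumes "cpl_contraction f"
  obtains c where "0 \<le> c" "c < 1" "\<And>x y. dist (f x) (f y) \<le> c * dist x y"
proof -
  let ?B = "breaking_points f"
  have fin: "finite ?B" by (rule finite_breaking_points[OF assms])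
  have finC: "finite (components (UNIV - ?B))"
    by (rule finite_components_Diff_finite) (simp_all add: fin)
  have "\<exists>r t. \<bar>r\<bar> < 1 \<and> (\<forall>x\<in>C. f x = r * x + t)" if C: "C \<in> components (UNIV - ?B)" for C
  proof -
    have "C \<noteq> {}" "topological_space_class.connected C" "C \<inter> ?B = {}"
      using C in_components_nonempty in_components_connected in_components_subset by blast+
    then obtain r t where "r \<in> {-1<..<1} - {0}" "\<forall>x\<in>C. f x = r * x + t"
      using cpl_contraction_affine_on[OF assms] by blast
    then show ?thesis by (intro exI[of _ r] exI[of _ t]) auto
  qed
  then obtain r t where rt: "\<And>C. C \<in> components (UNIV - ?B) \<Longrightarrow> \<bar>r C\<bar> < 1"
    "\<And>C x. C \<in> components (UNIV - ?B) \<Longrightarrow> x \<in> C \<Longrightarrow> f x = r C * x + t C" by metis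
  define c where "c = Max (insert 0 ((\<lambda>C. \<bar>r C\<bar>) ` components (UNIV - ?B)))"
  have c: "0 \<le> c" "c < 1" "\<And>C. C \<in> components (UNIV - ?B) \<Longrightarrow> \<bar>r C\<bar> \<le> c"
    unfolding c_def using finC rt(1) by auto
  define f' where "f' x = (if x \<in> ?B then 0 else r (connected_component_set (UNIV - ?B) x))" for x
  have f'_le: "\<bar>f' x\<bar> \<le> c" for x
    using c by (auto simp: f'_def componentsI)
  have deriv: "(f has_vector_derivative f' x) (at x)" if "x \<notin> ?B" for x
  proof -
    define C where "C = connected_component_set (UNIV - ?B) x"
    have C: "C \<in> components (UNIV - ?B)" "x \<in> C" using that by (auto simp: C_def componentsI)
    have "open (UNIV - ?B)" using fin by (simp add: finite_imp_closed open_Diff)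
    then have "open C" using C open_components by blast
    have "((\<lambda>x. r C * x + t C) has_field_derivative r C) (at x)"
      by (auto intro!: derivative_eq_intros)
    then have "(f has_field_derivative r C) (at x)"
      by (rule has_field_derivative_transform_within_open[OF _ \<open>open C\<close> \<open>x \<in> C\<close>])
        (use rt(2) C in simp)
    then show ?thesis
      using that by (simp add: f'_def C_def has_real_derivative_iff_has_vector_derivative)
  qed
  have cont: "continuous_on UNIV f" using assms unfolding cpl_contraction_def by blast
  have le: "dist (f x) (f y) \<le> c * dist x y" if "x \<le> y" for x y
  proof -
    have "(f' has_integral (f y - f x)) {x..y}"
      by (rule fundamental_theorem_of_calculus_interior_strong[OF fin that])
        (auto intro: deriv continuous_on_subset[OF cont])
    then have "norm (f y - f x) \<le> c * measure lborel (cbox x y)"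
      by (intro has_integral_bound[of c f']) (use c f'_le in auto)
    then show ?thesis using that by (simp add: dist_real_def abs_minus_commute)
  qed
  show ?thesis
  proof (rule that[OF c(1,2)])
    show "dist (f x) (f y) \<le> c * dist x y" for x y
      using le[of x y] le[of y x] by (cases "x \<le> y") (auto simp: dist_commute)
  qed
qed

section \<open>Backward orbits of finite sets\<close>

text \<open>All points of the orbit are kept inside \<open>I\<close>. For a bounded \<open>I\<close> this is what can make the set finite:
  the full backward orbit of a point under contractions is in general unbounded.\<close>

inductive_set preorbit :: "('a \<Rightarrow> 'a) set \<Rightarrow> 'a set \<Rightarrow> 'a set \<Rightarrow> 'a set"
  for F :: "('a \<Rightarrow> 'a) set" and I B :: "'a set"
  where
    base: "x \<in> I \<Longrightarrow> x \<in> B \<Longrightarrow> x \<in> preorbit F I B"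
  | step: "x \<in> I \<Longrightarrow> f \<in> F \<Longrightarrow> f x \<in> preorbit F I B \<Longrightarrow> x \<in> preorbit F I B"

lemma preorbit_subset: "preorbit F I B \<subseteq> I"
  by (auto elim: preorbit.cases)

text \<open>From a point \<open>x \<notin> \<Lambda>\<close> of the preorbit some forward orbit leads, outside \<open>\<Lambda>\<close>, to a point \<open>y\<close> that is in
  \<open>B\<close> or whose next image is in \<open>\<Lambda>\<close>. As the fibres are finite, there are only finitely many such \<open>y\<close>,
  and they have a positive minimal distance \<open>d\<close> from \<open>\<Lambda>\<close>. The maps contract distances to \<open>\<Lambda>\<close> by the
  factor \<open>c\<close>, so if \<open>y\<close> is reached in \<open>n\<close> steps, then \<open>d\<close> is at most \<open>c ^ n\<close> times the distance of \<open>x\<close>,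
  which the boundedness of \<open>I\<close> rules out for large \<open>n\<close>.\<close>

lemma finite_preorbit_if_finite_in_attractor:
  fixes F :: "('a::heine_borel \<Rightarrow> 'a) set"
  assumes "finite F" "finite B" "bounded I"
    and fibre: "\<And>f q. f \<in> F \<Longrightarrow> finite (f -` {q})"
    and lip: "\<And>f x y. f \<in> F \<Longrightarrow> dist (f x) (f y) \<le> c * dist x y"
    and c: "0 \<le> c" "c < 1"
    and "closed \<Lambda>" "\<Lambda> \<noteq> {}" and inv: "\<And>f. f \<in> F \<Longrightarrow> f ` \<Lambda> \<subseteq> \<Lambda>"
    and finP: "finite (preorbit F I B \<inter> \<Lambda>)"
  shows "finite (preorbit F I B)"
proof -
  define Q where "Q = preorbit F I B"
  have fibres: "finite (\<Union>f\<in>F. f -` A)" if "finite A" for A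
  proof -
    have "f -` A = (\<Union>q\<in>A. f -` {q})" for f :: "'a \<Rightarrow> 'a" by blast
    then show ?thesis using that \<open>finite F\<close> fibre by simp
  qed
  define pre where "pre A = (\<Union>f\<in>F. f -` A) \<inter> I" for A
  have fin_pre: "finite (pre A)" if "finite A" for A using fibres[OF that] by (simp add: pre_def)
  \<comment> \<open>The last points outside \<open>\<Lambda>\<close>: they are in \<open>B\<close> or their next image is in \<open>\<Lambda>\<close>.\<close>
  define exits where "exits = (B \<inter> I \<union> pre (Q \<inter> \<Lambda>)) - \<Lambda>"
  have fin_exits: "finite exits"
    using \<open>finite B\<close> fin_pre finP by (simp add: exits_def Q_def)
  have fin_gen: "finite ((pre ^^ n) exits)" for n
    by (induction n) (simp_all add: fin_exits fin_pre)
  have gens: "\<exists>n. x \<in> (pre ^^ n) exits" if "x \<in> Q" "x \<notin> \<Lambda>" for x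
    using that unfolding Q_def
  proof (induction rule: preorbit.induct)
    case (base x)
    then have "x \<in> (pre ^^ 0) exits" by (simp add: exits_def)
    then show ?case by blast
  next
    case (step x f)
    show ?case
    proof (cases "f x \<in> \<Lambda>")
      case True
      then have "x \<in> (pre ^^ 0) exits" using step by (auto simp: exits_def pre_def Q_def)
      then show ?thesis by blast
    next
      case False
      then obtain n where "f x \<in> (pre ^^ n) exits" using step.IH by blast
      then have "x \<in> (pre ^^ Suc n) exits" using step.hyps by (auto simp: pre_def)
      then show ?thesis by blast
    qed
  qed
  obtain d where d: "d > 0" "\<And>x. x \<in> exits \<Longrightarrow> d \<le> infdist x \<Lambda>"
  proof
    let ?d = "Min (insert 1 ((\<lambda>x. infdist x \<Lambda>) ` exits))"
    have "infdist x \<Lambda> > 0" if "x \<in> exits" for x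
      using that infdist_pos_not_in_closed[OF \<open>closed \<Lambda>\<close> \<open>\<Lambda> \<noteq> {}\<close>] by (simp add: exits_def)
    then show "?d > 0" using fin_exits by simp
    show "?d \<le> infdist x \<Lambda>" if "x \<in> exits" for x using fin_exits that by simp
  qed
  have shrink: "infdist (f x) \<Lambda> \<le> c * infdist x \<Lambda>" if "f \<in> F" for f x
  proof -
    obtain y where y: "y \<in> \<Lambda>" "infdist x \<Lambda> = dist x y"
      using infdist_attains_inf[OF \<open>closed \<Lambda>\<close> \<open>\<Lambda> \<noteq> {}\<close>] by blast
    have "infdist (f x) \<Lambda> \<le> dist (f x) (f y)"
      using inv[OF that] y(1) by (intro infdist_le) blast
    then show ?thesis using lip[OF that, of x y] y(2) by simp
  qed
  have far: "d \<le> c ^ n * infdist x \<Lambda>" if "x \<in> (pre ^^ n) exits" for n x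
    using that
  proof (induction n arbitrary: x)
    case (Suc n)
    then have "x \<in> pre ((pre ^^ n) exits)" by simp
    then obtain f where f: "f \<in> F" "f x \<in> (pre ^^ n) exits"
      unfolding pre_def[of "(pre ^^ n) exits"] by blast
    have "d \<le> c ^ n * infdist (f x) \<Lambda>" using Suc.IH f(2) by blast
    also have "\<dots> \<le> c ^ n * (c * infdist x \<Lambda>)"
      using shrink[OF f(1)] c(1) by (intro mult_left_mono) auto
    finally show ?case by (simp add: mult_ac)
  qed (use d in simp)
  obtain p where "p \<in> \<Lambda>" using \<open>\<Lambda> \<noteq> {}\<close> by blast
  obtain R where "\<And>x. x \<in> I \<Longrightarrow> dist p x \<le> R"
    using \<open>bounded I\<close> bounded_any_center[of I p] by blast
  then have R: "infdist x \<Lambda> \<le> R" if "x \<in> I" for x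
    using that infdist_le2[OF \<open>p \<in> \<Lambda>\<close>] by (metis dist_commute)
  have "(\<lambda>n. c ^ n * R) \<longlonglongrightarrow> 0"
    using c by (intro tendsto_mult_left_zero LIMSEQ_realpow_zero)
  then have "\<forall>\<^sub>F n in sequentially. c ^ n * R < d"
    using d(1) by (rule order_tendstoD)
  then obtain N where N: "\<And>n. n \<ge> N \<Longrightarrow> c ^ n * R < d" by (auto simp: eventually_sequentially)
  have "Q \<subseteq> (Q \<inter> \<Lambda>) \<union> (\<Union>n<N. (pre ^^ n) exits)"
  proof
    fix x assume x: "x \<in> Q"
    then have "x \<in> I" using subsetD[OF preorbit_subset] by (simp add: Q_def)
    show "x \<in> (Q \<inter> \<Lambda>) \<union> (\<Union>n<N. (pre ^^ n) exits)"
    proof (cases "x \<in> \<Lambda>")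
      case False
      then obtain n where n: "x \<in> (pre ^^ n) exits" using gens x by blast
      have "d \<le> c ^ n * R"
        using far[OF n] mult_left_mono[OF R[OF \<open>x \<in> I\<close>], of "c ^ n"] c(1) by simp
      then have "n < N" using N by (meson not_le)
      then show ?thesis using n by blast
    qed (use x in simp)
  qed
  moreover have "finite ((Q \<inter> \<Lambda>) \<union> (\<Union>n<N. (pre ^^ n) exits))"
    using finP fin_gen by (simp add: Q_def)
  ultimately show ?thesis unfolding Q_def by (rule finite_subset)
qed

section \<open>Codings and periodicity\<close>

lemma periodic_seq_period:
  assumes "periodic_seq i"
  obtains p where "p > 0" "\<And>n k. i (n + k * p) = i n"
proof -
  obtain w where "w \<noteq> []" "\<And>n. i n = w ! (n mod length w)"
    using assms unfolding periodic_seq_def by blast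
  then show ?thesis by (intro that[of "length w"]) auto
qed

definition splice_seq :: "(nat \<Rightarrow> 'a) \<Rightarrow> nat \<Rightarrow> (nat \<Rightarrow> 'a) \<Rightarrow> nat \<Rightarrow> 'a" where
  "splice_seq i n j k = (if k < n then i k else j (k - n))"

text \<open>Let \<open>u\<close> be a prefix of \<open>i\<close> whose length \<open>m\<close> is a multiple of a period of \<open>j\<close>. If \<open>uj\<close> is periodic, then
  moving far to the right by a common multiple of \<open>m\<close> and of a period of \<open>uj\<close> leads from the \<open>n\<close>-th
  symbol of \<open>u\<close> into \<open>j\<close>, at a place that is congruent to \<open>n\<close> modulo the period of \<open>j\<close>.\<close>

lemma eq_if_splices_periodic:
  assumes "periodic_seq j" "p > 0" and spl: "\<And>k. periodic_seq (splice_seq i (k * p) j)"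
  shows "i = j"
proof
  fix n
  obtain q where q: "q > 0" "\<And>n k. j (n + k * q) = j n"
    using periodic_seq_period[OF assms(1)] by blast
  \<comment> \<open>The factor \<open>q\<close> is for the congruence, the factor \<open>Suc n\<close> makes the prefix contain position \<open>n\<close>,
    and the factor \<open>p\<close> is demanded by the hypothesis on splices.\<close>
  define m where "m = Suc n * q * p"
  have "Suc n * 1 * 1 \<le> m"
    unfolding m_def using q(1) \<open>p > 0\<close> by (intro mult_le_mono) auto
  then have m: "n < m" by simp
  obtain s where s: "s > 0" "\<And>k l. splice_seq i m j (k + l * s) = splice_seq i m j k"
    using periodic_seq_period[OF spl[of "Suc n * q"]] unfolding m_def by blast
  obtain s' where s': "s = Suc s'" using s(1) gr0_implies_Suc by blast
  have "n + m * s = m + (n + (Suc n * p * s') * q)"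
    by (simp add: m_def s' algebra_simps)
  then have shift: "n + m * s - m = n + (Suc n * p * s') * q" "m \<le> n + m * s" by simp_all
  have "i n = splice_seq i m j n" using m by (simp add: splice_seq_def)
  also have "\<dots> = splice_seq i m j (n + m * s)" using s(2)[of n m] by simp
  also have "\<dots> = j (n + m * s - m)" using shift(2) by (simp add: splice_seq_def)
  also have "\<dots> = j n" unfolding shift(1) by (rule q(2))
  finally show "i n = j n" .
qed

locale contractive_ifs =
  fixes fs :: "(real \<Rightarrow> real) list" and \<Lambda> :: "real set" and c :: real
  assumes attractor: "cplifs_attractor fs \<Lambda>"
    and lipschitz: "\<And>f x y. f \<in> set fs \<Longrightarrow> dist (f x) (f y) \<le> c * dist x y"
    and ratio: "0 \<le> c" "c < 1"
begin

abbreviation "\<Omega> \<equiv> symbolic_space fs"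
abbreviation "\<pi> \<equiv> natural_projection fs"

lemma compact_attractor: "compact \<Lambda>" and attractor_nonempty: "\<Lambda> \<noteq> {}"
  and attractor_eq: "\<Lambda> = (\<Union>f\<in>set fs. f ` \<Lambda>)"
proof -
  have "(\<Union>k<length fs. (fs ! k) ` \<Lambda>) = (\<Union>f\<in>set fs. f ` \<Lambda>)"
  proof -
    have "set fs = (\<lambda>k. fs ! k) ` {..<length fs}" by (auto simp: set_conv_nth)
    then show ?thesis by (simp only: image_image)
  qed
  then show "compact \<Lambda>" "\<Lambda> \<noteq> {}" "\<Lambda> = (\<Union>f\<in>set fs. f ` \<Lambda>)"
    using attractor unfolding cplifs_attractor_def by simp_all
qed

lemma symbol_in_set: "i \<in> \<Omega> \<Longrightarrow> fs ! i n \<in> set fs"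
  by (simp add: symbolic_space_def)

lemma shift_in_symbolic_space: "i \<in> \<Omega> \<Longrightarrow> (\<lambda>k. i (n + k)) \<in> \<Omega>"
  by (simp add: symbolic_space_def)

lemma splice_in_symbolic_space: "i \<in> \<Omega> \<Longrightarrow> j \<in> \<Omega> \<Longrightarrow> splice_seq i n j \<in> \<Omega>"
  by (simp add: symbolic_space_def splice_seq_def)

lemma prefix_map_dist:
  "i \<in> \<Omega> \<Longrightarrow> dist (prefix_map fs i n x) (prefix_map fs i n y) \<le> c ^ n * dist x y"
proof (induction n arbitrary: x y)
  case (Suc n)
  have "dist (prefix_map fs i (Suc n) x) (prefix_map fs i (Suc n) y)
      \<le> c ^ n * dist ((fs ! i n) x) ((fs ! i n) y)"
    using Suc by simp
  also have "\<dots> \<le> c ^ n * (c * dist x y)"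
    using Suc.prems ratio(1) by (intro mult_left_mono lipschitz symbol_in_set) auto
  finally show ?case by (simp add: mult_ac)
qed simp

lemma prefix_map_in_attractor: "i \<in> \<Omega> \<Longrightarrow> x \<in> \<Lambda> \<Longrightarrow> prefix_map fs i n x \<in> \<Lambda>"
proof (induction n arbitrary: x)
  case (Suc n)
  have "(fs ! i n) x \<in> \<Lambda>" using Suc.prems attractor_eq symbol_in_set by blast
  then show ?case using Suc by simp
qed simp

lemma continuous_prefix_map: "i \<in> \<Omega> \<Longrightarrow> continuous_on S (prefix_map fs i n)"
  by (rule lipschitz_on_continuous_on[of "c ^ n"], rule lipschitz_onI)
    (use prefix_map_dist ratio in auto)

lemma prefix_map_add:
  "prefix_map fs i (n + m) x = prefix_map fs i n (prefix_map fs (\<lambda>k. i (n + k)) m x)"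
  by (induction m arbitrary: x) simp_all

lemma prefix_map_cong:
  "(\<And>k. k < n \<Longrightarrow> i k = j k) \<Longrightarrow> prefix_map fs i n = prefix_map fs j n"
  by (induction n) simp_all

text \<open>The images \<open>prefix_map fs i n ` \<Lambda>\<close> form a decreasing sequence of compact sets. A common point of
  them is the limit, whatever the starting point, because their diameters tend to \<open>0\<close>.\<close>

lemma natural_projection_limit:
  assumes i: "i \<in> \<Omega>"
  shows "\<pi> i \<in> \<Lambda>" and "(\<lambda>n. prefix_map fs i n x) \<longlonglongrightarrow> \<pi> i"
proof -
  define K where "K n = prefix_map fs i n ` \<Lambda>" for n
  have "compact (K n)" "K n \<noteq> {}" for n
    unfolding K_def using compact_attractor attractor_nonempty continuous_prefix_map[OF i]
    by (auto intro: compact_continuous_image)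
  moreover have "K n \<subseteq> K m" if "m \<le> n" for m n
  proof (rule lift_Suc_antimono_le[OF _ that])
    show "K (Suc n) \<subseteq> K n" for n
      unfolding K_def using attractor_eq symbol_in_set[OF i, of n] by auto
  qed
  ultimately have "\<Inter>(range K) \<noteq> {}" by (rule compact_nest)
  then obtain z where z: "z \<in> K n" for n by blast
  have "\<exists>M. \<forall>y\<in>\<Lambda>. dist u y \<le> M" for u
    using bounded_any_center compact_imp_bounded[OF compact_attractor] by blast
  then obtain M where M: "\<And>u y. y \<in> \<Lambda> \<Longrightarrow> dist u y \<le> M u" by metis
  have lim: "(\<lambda>n. prefix_map fs i n u) \<longlonglongrightarrow> z" for u
  proof (rule metric_tendsto_imp_tendsto)
    show "(\<lambda>n. c ^ n * M u) \<longlonglongrightarrow> 0"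
      using ratio by (intro tendsto_mult_left_zero LIMSEQ_realpow_zero)
    have "dist (prefix_map fs i n u) z \<le> dist (c ^ n * M u) 0" for n
    proof -
      obtain y where y: "y \<in> \<Lambda>" "z = prefix_map fs i n y" using z[of n] unfolding K_def by blast
      have "dist (prefix_map fs i n u) z \<le> c ^ n * dist u y"
        unfolding y(2) by (rule prefix_map_dist[OF i])
      also have "\<dots> \<le> c ^ n * M u"
        using M y(1) ratio(1) by (intro mult_left_mono) auto
      finally show ?thesis by simp
    qed
    then show "\<forall>\<^sub>F n in sequentially. dist (prefix_map fs i n u) z \<le> dist (c ^ n * M u) 0"
      by simp
  qed
  then have "\<pi> i = z" unfolding natural_projection_def by (rule limI)
  then show "(\<lambda>n. prefix_map fs i n x) \<longlonglongrightarrow> \<pi> i" using lim by simp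
  show "\<pi> i \<in> \<Lambda>" using z[of 0] \<open>\<pi> i = z\<close> by (simp add: K_def)
qed

lemma natural_projection_shift:
  assumes i: "i \<in> \<Omega>"
  shows "\<pi> i = prefix_map fs i n (\<pi> (\<lambda>k. i (n + k)))"
proof (rule LIMSEQ_unique)
  show "(\<lambda>m. prefix_map fs i (n + m) 0) \<longlonglongrightarrow> \<pi> i"
    using LIMSEQ_ignore_initial_segment[OF natural_projection_limit(2)[OF i], of n 0]
    by (simp add: add.commute)
  show "(\<lambda>m. prefix_map fs i (n + m) 0) \<longlonglongrightarrow> prefix_map fs i n (\<pi> (\<lambda>k. i (n + k)))"
    unfolding prefix_map_add
    using continuous_on_tendsto_compose[OF continuous_prefix_map[OF i, of UNIV]
        natural_projection_limit(2)[OF shift_in_symbolic_space[OF i]]] by simp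
qed

lemma natural_projection_splice:
  assumes "i \<in> \<Omega>" "j \<in> \<Omega>"
  shows "\<pi> (splice_seq i n j) = prefix_map fs i n (\<pi> j)"
proof -
  have "prefix_map fs (splice_seq i n j) n = prefix_map fs i n"
    by (rule prefix_map_cong) (simp add: splice_seq_def)
  moreover have "(\<lambda>k. splice_seq i n j (n + k)) = j" by (simp add: splice_seq_def)
  ultimately show ?thesis
    using natural_projection_shift[of "splice_seq i n j" n] splice_in_symbolic_space[OF assms]
    by (simp only:)
qed

text \<open>Choosing preimages in \<open>\<Lambda>\<close> again and again yields the symbols of a coding.\<close>

lemma coding_exists:
  assumes "x \<in> \<Lambda>"
  obtains i where "i \<in> \<Omega>" "\<pi> i = x"
proof -
  have "\<forall>x\<in>\<Lambda>. \<exists>k y. k < length fs \<and> y \<in> \<Lambda> \<and> x = (fs ! k) y"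
    using attractor unfolding cplifs_attractor_def by blast
  then obtain k y where ky: "\<And>x. x \<in> \<Lambda> \<Longrightarrow> k x < length fs \<and> y x \<in> \<Lambda> \<and> x = (fs ! k x) (y x)"
    by metis
  define i where "i n = k ((y ^^ n) x)" for n
  have mem: "(y ^^ n) x \<in> \<Lambda>" for n by (induction n) (use assms ky in auto)
  have i: "i \<in> \<Omega>" using ky[OF mem] by (simp add: symbolic_space_def i_def)
  have pre: "prefix_map fs i n ((y ^^ n) x) = x" for n
  proof (induction n)
    case (Suc n)
    then show ?case using ky[OF mem[of n]] by (simp add: i_def)
  qed simp
  obtain M where M: "\<And>u v. u \<in> \<Lambda> \<Longrightarrow> v \<in> \<Lambda> \<Longrightarrow> dist u v \<le> M"
    using bounded_two_points compact_attractor compact_imp_bounded by metis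
  have "(\<lambda>n. prefix_map fs i n x) \<longlonglongrightarrow> x"
  proof (rule metric_tendsto_imp_tendsto)
    show "(\<lambda>n. c ^ n * M) \<longlonglongrightarrow> 0"
      using ratio by (intro tendsto_mult_left_zero LIMSEQ_realpow_zero)
    have "dist (prefix_map fs i n x) x \<le> dist (c ^ n * M) 0" for n
    proof -
      have "dist (prefix_map fs i n x) x \<le> c ^ n * dist x ((y ^^ n) x)"
        using prefix_map_dist[OF i, of n x "(y ^^ n) x"] by (simp add: pre)
      also have "\<dots> \<le> c ^ n * M"
        using M mem assms ratio(1) by (intro mult_left_mono) auto
      finally show ?thesis by simp
    qed
    then show "\<forall>\<^sub>F n in sequentially. dist (prefix_map fs i n x) x \<le> dist (c ^ n * M) 0"
      by simp
  qed
  then have "\<pi> i = x" using natural_projection_limit(2)[OF i] LIMSEQ_unique by blast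
  then show ?thesis using i that by blast
qed

text \<open>If \<open>p\<close> is a period of the coding \<open>i\<close> of \<open>b\<close>, then the composition of the first \<open>k * p\<close> maps of \<open>i\<close> fixes
  \<open>b\<close>. Hence the first \<open>k * p\<close> symbols of \<open>i\<close>, followed by another coding \<open>j\<close> of \<open>b\<close>, again code \<open>b\<close>, and
  all these splices are periodic.\<close>

lemma coding_unique_if_codings_periodic:
  assumes per: "\<And>i. i \<in> \<Omega> \<Longrightarrow> \<pi> i = b \<Longrightarrow> periodic_seq i"
    and ij: "i \<in> \<Omega>" "\<pi> i = b" "j \<in> \<Omega>" "\<pi> j = b"
  shows "i = j"
proof -
  obtain p where p: "p > 0" "\<And>n k. i (n + k * p) = i n"
    using periodic_seq_period[OF per[OF ij(1,2)]] by blast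
  show ?thesis
  proof (rule eq_if_splices_periodic[OF per[OF ij(3,4)] p(1)])
    fix k
    have "(\<lambda>l. i (k * p + l)) = i" using p(2) by (simp add: add.commute)
    then have "prefix_map fs i (k * p) b = b"
      using natural_projection_shift[OF ij(1), of "k * p"] ij(2) by simp
    then have "\<pi> (splice_seq i (k * p) j) = b"
      using natural_projection_splice[OF ij(1,3)] ij(4) by simp
    then show "periodic_seq (splice_seq i (k * p) j)"
      using per splice_in_symbolic_space ij by blast
  qed
qed

text \<open>Applying the maps of a period word of \<open>i\<close> repeatedly to a second point \<open>z\<close> of \<open>\<Lambda>\<close> approaches \<open>\<pi> i\<close>. The
  value \<open>\<pi> i\<close> is never attained, as this would extend a coding of \<open>z\<close> to a second coding of \<open>\<pi> i\<close>.\<close>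

lemma limit_point_if_unique_periodic_coding:
  assumes i: "i \<in> \<Omega>" and "p > 0" and per: "\<And>n k. i (n + k * p) = i n"
    and uniq: "\<And>j. j \<in> \<Omega> \<Longrightarrow> \<pi> j = \<pi> i \<Longrightarrow> j = i"
    and "\<Lambda> \<noteq> {\<pi> i}"
  shows "\<pi> i islimpt \<Lambda>"
proof -
  obtain z where z: "z \<in> \<Lambda>" "z \<noteq> \<pi> i"
    using \<open>\<Lambda> \<noteq> {\<pi> i}\<close> attractor_nonempty by blast
  obtain j where j: "j \<in> \<Omega>" "\<pi> j = z" using coding_exists[OF z(1)] by blast
  define y where "y k = prefix_map fs i (k * p) z" for k
  have "y k \<noteq> \<pi> i" for k
  proof
    assume "y k = \<pi> i"
    then have "\<pi> (splice_seq i (k * p) j) = \<pi> i"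
      using natural_projection_splice[OF i j(1)] j(2) by (simp add: y_def)
    then have spl: "splice_seq i (k * p) j = i"
      using uniq splice_in_symbolic_space[OF i j(1)] by blast
    have "j n = i n" for n
    proof -
      have "j n = splice_seq i (k * p) j (n + k * p)" by (simp add: splice_seq_def)
      also have "\<dots> = i n" unfolding spl by (rule per)
      finally show ?thesis .
    qed
    then have "j = i" by blast
    then show False using z j by simp
  qed
  moreover have "y k \<in> \<Lambda>" for k
    unfolding y_def by (rule prefix_map_in_attractor[OF i z(1)])
  moreover have "y \<longlonglongrightarrow> \<pi> i"
  proof -
    have "strict_mono (\<lambda>k. k * p)" using \<open>p > 0\<close> by (simp add: strict_mono_def)
    then have "((\<lambda>n. prefix_map fs i n z) \<circ> (\<lambda>k. k * p)) \<longlonglongrightarrow> \<pi> i"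
      by (rule LIMSEQ_subseq_LIMSEQ[OF natural_projection_limit(2)[OF i]])
    moreover have "y = (\<lambda>k. prefix_map fs i (k * p) z)" by (simp add: y_def fun_eq_iff)
    ultimately show ?thesis by (simp only: o_def)
  qed
  ultimately show ?thesis unfolding islimpt_sequential by blast
qed

text \<open>Uniqueness of codings is inherited backwards: prepending a symbol to a coding of \<open>x\<close> gives a coding
  of an image of \<open>x\<close>, so that \<open>x\<close> is coded by the shifted coding of that image and by nothing else.\<close>

lemma coding_in_preorbit:
  assumes per: "\<forall>i\<in>\<Omega>. \<pi> i \<in> B \<longrightarrow> periodic_seq i"
    and x: "x \<in> preorbit (set fs) I B" "x \<in> \<Lambda>"
  obtains i n where "i \<in> \<Omega>" "\<pi> i \<in> B" "\<pi> (\<lambda>k. i (n + k)) = x"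
    "\<And>j. j \<in> \<Omega> \<Longrightarrow> \<pi> j = x \<Longrightarrow> j = (\<lambda>k. i (n + k))"
proof -
  have "\<exists>i\<in>\<Omega>. \<pi> i \<in> B \<and> (\<exists>n. \<forall>j\<in>\<Omega>. \<pi> j = x \<longrightarrow> j = (\<lambda>k. i (n + k)))"
    using x
  proof (induction rule: preorbit.induct)
    case (base b)
    obtain i where i: "i \<in> \<Omega>" "\<pi> i = b" using coding_exists base.prems by blast
    have "j = i" if "j \<in> \<Omega>" "\<pi> j = b" for j
      by (rule coding_unique_if_codings_periodic[OF _ that i]) (use per base.hyps(2) in simp)
    then have "\<forall>j\<in>\<Omega>. \<pi> j = b \<longrightarrow> j = (\<lambda>k. i (0 + k))" by simp
    then show ?case using i base.hyps(2) by blast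
  next
    case (step x f)
    have "f x \<in> \<Lambda>" using step.hyps step.prems attractor_eq by blast
    then obtain i n where i: "i \<in> \<Omega>" "\<pi> i \<in> B"
      "\<And>j. j \<in> \<Omega> \<Longrightarrow> \<pi> j = f x \<Longrightarrow> j = (\<lambda>k. i (n + k))" using step.IH by blast
    obtain m where m: "m < length fs" "f = fs ! m" using step.hyps by (metis in_set_conv_nth)
    then have m': "(\<lambda>_. m) \<in> \<Omega>" by (simp add: symbolic_space_def)
    have "j = (\<lambda>k. i (Suc n + k))" if j: "j \<in> \<Omega>" "\<pi> j = x" for j
    proof -
      have "\<pi> (splice_seq (\<lambda>_. m) 1 j) = f x"
        using natural_projection_splice[OF m' j(1), of 1] j(2) m(2) by simp
      then have "splice_seq (\<lambda>_. m) 1 j = (\<lambda>k. i (n + k))"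
        using i(3) splice_in_symbolic_space[OF m' j(1)] by blast
      then have "splice_seq (\<lambda>_. m) 1 j (Suc k) = i (n + Suc k)" for k by simp
      then show ?thesis by (simp add: splice_seq_def fun_eq_iff)
    qed
    then show ?case using i(1,2) by blast
  qed
  then obtain i n where i: "i \<in> \<Omega>" "\<pi> i \<in> B"
    "\<And>j. j \<in> \<Omega> \<Longrightarrow> \<pi> j = x \<Longrightarrow> j = (\<lambda>k. i (n + k))" by blast
  obtain j where "j \<in> \<Omega>" "\<pi> j = x" using coding_exists[OF x(2)] by blast
  then have "\<pi> (\<lambda>k. i (n + k)) = x" using i(3) by blast
  then show ?thesis using that i by blast
qed

text \<open>Each of the finitely many points of \<open>B \<inter> \<Lambda>\<close> contributes the projections of the shifts of its only
  coding, and a periodic sequence has finitely many shifts.\<close>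

lemma finite_preorbit_in_attractor:
  assumes "finite B"
    and per: "\<forall>i\<in>\<Omega>. \<pi> i \<in> B \<longrightarrow> periodic_seq i"
  shows "finite (preorbit (set fs) I B \<inter> \<Lambda>)"
proof -
  define codes where "codes = {i \<in> \<Omega>. \<pi> i \<in> B}"
  have "inj_on \<pi> codes"
  proof (rule inj_onI)
    fix i j assume "i \<in> codes" "j \<in> codes" "\<pi> i = \<pi> j"
    then show "i = j"
      by (intro coding_unique_if_codings_periodic[of "\<pi> j"]) (use per in \<open>auto simp: codes_def\<close>)
  qed
  moreover have "\<pi> ` codes \<subseteq> B" by (auto simp: codes_def)
  ultimately have fin: "finite codes" using \<open>finite B\<close> by (metis inj_on_finite)
  have orbit: "finite (range (\<lambda>n. \<pi> (\<lambda>k. i (n + k))))" if "i \<in> codes" for i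
  proof -
    have "periodic_seq i" using that per by (simp add: codes_def)
    then obtain p where p: "p > 0" "\<And>n k. i (n + k * p) = i n"
      using periodic_seq_period by blast
    have mod: "(\<lambda>k. i (n + k)) = (\<lambda>k. i (n mod p + k))" for n
    proof
      fix k
      have "n + k = (n mod p + k) + (n div p) * p" using mod_div_mult_eq[of n p] by linarith
      then show "i (n + k) = i (n mod p + k)" using p(2) by metis
    qed
    have "range (\<lambda>n. \<pi> (\<lambda>k. i (n + k))) \<subseteq> (\<lambda>n. \<pi> (\<lambda>k. i (n + k))) ` {..<p}"
    proof (intro image_subsetI)
      fix n show "\<pi> (\<lambda>k. i (n + k)) \<in> (\<lambda>n. \<pi> (\<lambda>k. i (n + k))) ` {..<p}"
        by (rule image_eqI[OF arg_cong[OF mod]]) (use p(1) in simp)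
    qed
    then show ?thesis by (rule finite_subset) simp
  qed
  have "preorbit (set fs) I B \<inter> \<Lambda> \<subseteq> (\<Union>i\<in>codes. range (\<lambda>n. \<pi> (\<lambda>k. i (n + k))))"
  proof
    fix x assume "x \<in> preorbit (set fs) I B \<inter> \<Lambda>"
    then have x: "x \<in> preorbit (set fs) I B" "x \<in> \<Lambda>" by simp_all
    obtain i n where "i \<in> \<Omega>" "\<pi> i \<in> B" "\<pi> (\<lambda>k. i (n + k)) = x"
      using coding_in_preorbit[OF per x] by blast
    then show "x \<in> (\<Union>i\<in>codes. range (\<lambda>n. \<pi> (\<lambda>k. i (n + k))))" by (auto simp: codes_def)
  qed
  then show ?thesis using fin orbit by (meson finite_UN finite_subset)
qed

lemma preorbit_limit_point:
  assumes per: "\<forall>i\<in>\<Omega>. \<pi> i \<in> B \<longrightarrow> periodic_seq i"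
    and x: "x \<in> preorbit (set fs) I B" "x \<in> \<Lambda>" and "\<Lambda> \<noteq> {x}"
  shows "x islimpt \<Lambda>"
proof -
  obtain i n where i: "i \<in> \<Omega>" "\<pi> i \<in> B" "\<pi> (\<lambda>k. i (n + k)) = x"
    and uniq: "\<And>j. j \<in> \<Omega> \<Longrightarrow> \<pi> j = x \<Longrightarrow> j = (\<lambda>k. i (n + k))"
    using coding_in_preorbit[OF per x] by blast
  obtain p where p: "p > 0" "\<And>n k. i (n + k * p) = i n"
    using periodic_seq_period per i(1,2) by blast
  have "\<pi> (\<lambda>k. i (n + k)) islimpt \<Lambda>"
  proof (rule limit_point_if_unique_periodic_coding[OF shift_in_symbolic_space[OF i(1)] p(1)])
    show "i (n + (m + k * p)) = i (n + m)" for m k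
      using p(2)[of "n + m" k] by (simp add: add.assoc)
  qed (use uniq i(3) \<open>\<Lambda> \<noteq> {x}\<close> in auto)
  then show ?thesis unfolding i(3) .
qed

end

section \<open>Attractors whose breaking points have periodic codings\<close>

text \<open>One vertex with one loop, which carries the contraction by \<open>1 / 2\<close> with fixed point \<open>x\<close>.\<close>

lemma singleton_gdifs:
  "\<exists>(G :: (nat, nat) pre_digraph) r t. self_similar_gdifs G r t \<and> gdifs_attractor G r t {x}"
proof -
  have "\<exists>(G :: (nat, nat) pre_digraph) r t.
          self_similar_gdifs G r t \<and> gdifs_attractor G r t (\<Union>v\<in>{()}. {x})"
    by (rule strongly_connected_family_is_gdifs[where E = "{()}" and src = id and tgt = id
          and \<rho> = "\<lambda>_. 1 / 2" and \<tau> = "\<lambda>_. x / 2"]) auto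
  then show ?thesis by simp
qed

lemma cplifs_common_ratio:
  assumes "cplifs fs"
  obtains c where "0 \<le> c" "c < 1"
    "\<And>f x y. f \<in> set fs \<Longrightarrow> dist (f x) (f y) \<le> c * dist x y"
proof -
  have "\<exists>c. 0 \<le> c \<and> c < 1 \<and> (\<forall>x y. dist (f x) (f y) \<le> c * dist x y)" if "f \<in> set fs" for f
    using assms that unfolding cplifs_def by (meson cpl_contraction_lipschitz)
  then obtain k where k: "\<And>f. f \<in> set fs \<Longrightarrow> 0 \<le> k f \<and> k f < 1"
    "\<And>f x y. f \<in> set fs \<Longrightarrow> dist (f x) (f y) \<le> k f * dist x y" by metis
  define c where "c = Max (insert 0 (k ` set fs))"
  have "0 \<le> c" "c < 1" unfolding c_def using k(1) by auto
  moreover have "dist (f x) (f y) \<le> c * dist x y" if "f \<in> set fs" for f x y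
  proof -
    have "k f \<le> c" unfolding c_def using that by simp
    then have "k f * dist x y \<le> c * dist x y" by (simp add: mult_right_mono)
    then show ?thesis using k(2)[OF that, of x y] by linarith
  qed
  ultimately show ?thesis by (rule that)
qed

text \<open>The interval around \<open>0\<close> of radius \<open>R\<close> is invariant as soon as \<open>\<bar>f 0\<bar> < (1 - c) * R\<close> for all \<open>f\<close>.\<close>

lemma invariant_interval:
  fixes F :: "(real \<Rightarrow> real) set"
  assumes "finite F" "0 \<le> c" "c < 1"
    and lip: "\<And>f x y. f \<in> F \<Longrightarrow> dist (f x) (f y) \<le> c * dist x y"
    and "bounded \<Lambda>"
  obtains R where "\<Lambda> \<subseteq> {-R<..<R}" "\<And>f. f \<in> F \<Longrightarrow> f ` {-R<..<R} \<subseteq> {-R<..<R}"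
proof -
  obtain b where b: "\<And>x. x \<in> \<Lambda> \<Longrightarrow> \<bar>x\<bar> \<le> b"
    using \<open>bounded \<Lambda>\<close> by (auto simp: bounded_iff)
  define M where "M = Max (insert 0 ((\<lambda>f. \<bar>f 0\<bar>) ` F)) + 1"
  have M: "\<bar>f 0\<bar> < M" if "f \<in> F" for f
  proof -
    have "\<bar>f 0\<bar> \<le> Max (insert 0 ((\<lambda>f. \<bar>f 0\<bar>) ` F))" using \<open>finite F\<close> that by simp
    then show ?thesis by (simp add: M_def)
  qed
  define R where "R = max (M / (1 - c)) (b + 1)"
  have "M / (1 - c) \<le> R" by (simp add: R_def)
  then have MR: "M + c * R \<le> R" using \<open>c < 1\<close> by (simp add: field_simps)
  show ?thesis
  proof (rule that[of R])
    show "\<Lambda> \<subseteq> {-R<..<R}"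
    proof
      fix x assume "x \<in> \<Lambda>"
      then have "\<bar>x\<bar> < R" using b[of x] by (simp add: R_def)
      then show "x \<in> {-R<..<R}" by (simp add: abs_less_iff)
    qed
    show "f ` {-R<..<R} \<subseteq> {-R<..<R}" if f: "f \<in> F" for f
    proof (intro image_subsetI)
      fix x assume "x \<in> {-R<..<R}"
      then have "c * \<bar>x\<bar> \<le> c * R" using \<open>0 \<le> c\<close> by (intro mult_left_mono) auto
      moreover have "\<bar>f x - f 0\<bar> \<le> c * \<bar>x\<bar>" using lip[OF f, of x 0] by (simp add: dist_real_def)
      ultimately have "\<bar>f x\<bar> < R" using M[OF f] MR by linarith
      then show "f x \<in> {-R<..<R}" by (simp add: abs_less_iff)
    qed
  qed
qed

theorem theorem3p2:
  fixes fs :: "(real \<Rightarrow> real) list" and \<Lambda> :: "real set"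
  assumes "cplifs fs"
    and "cplifs_attractor fs \<Lambda>"
    and "\<And>f b \<ii>. \<lbrakk>f \<in> set fs; b \<in> breaking_points f; \<ii> \<in> symbolic_space fs;
            natural_projection fs \<ii> = b\<rbrakk> \<Longrightarrow> periodic_seq \<ii>"
  shows "\<exists>(G :: (nat, nat) pre_digraph) r t.
           self_similar_gdifs G r t \<and> gdifs_attractor G r t \<Lambda>"
proof (cases "\<exists>x. \<Lambda> = {x}")
  case True
  then show ?thesis using singleton_gdifs by blast
next
  case False
  have cpl: "cpl_contraction f" if "f \<in> set fs" for f
    using assms(1) that by (simp add: cplifs_def)
  obtain c where c: "0 \<le> c" "c < 1"
    and lip: "\<And>f x y. f \<in> set fs \<Longrightarrow> dist (f x) (f y) \<le> c * dist x y"
    using cplifs_common_ratio[OF assms(1)] by blast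
  interpret contractive_ifs fs \<Lambda> c
    using assms(2) lip c by unfold_locales
  obtain R where R: "\<Lambda> \<subseteq> {-R<..<R}" "\<And>f. f \<in> set fs \<Longrightarrow> f ` {-R<..<R} \<subseteq> {-R<..<R}"
    using invariant_interval[OF finite_set c lip compact_imp_bounded[OF compact_attractor]] by blast
  define B where "B = (\<Union>f\<in>set fs. breaking_points f)"
  define Q where "Q = preorbit (set fs) {-R<..<R} B"
  define U where "U = {-R<..<R} - Q"
  have finB: "finite B" unfolding B_def using cpl by (simp add: finite_breaking_points)
  have per: "\<forall>i\<in>\<Omega>. \<pi> i \<in> B \<longrightarrow> periodic_seq i"
    using assms(3) unfolding B_def by blast
  have finQ: "finite Q"
    unfolding Q_def
  proof (rule finite_preorbit_if_finite_in_attractor[OF finite_set finB _ _ lip c _ attractor_nonempty])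
    show "f ` \<Lambda> \<subseteq> \<Lambda>" if "f \<in> set fs" for f using that attractor_eq by blast
    show "finite (preorbit (set fs) {-R<..<R} B \<inter> \<Lambda>)"
      by (rule finite_preorbit_in_attractor[OF finB per])
  qed (use cpl cpl_contraction_finite_fibre compact_attractor in \<open>auto simp: compact_imp_closed\<close>)
  show ?thesis
  proof (rule gdifs_of_invariant_open_set[OF finite_set lip c compact_attractor
        attractor_nonempty attractor_eq])
    show "open U" unfolding U_def using finQ by (simp add: finite_imp_closed open_Diff)
    show "finite (components U)"
      unfolding U_def using finQ by (intro finite_components_Diff_finite) simp_all
    show "f ` U \<subseteq> U" if "f \<in> set fs" for f
    proof (intro image_subsetI)
      fix x assume x: "x \<in> U"
      then have "f x \<notin> Q" using preorbit.step[OF _ that] unfolding U_def Q_def by blast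
      then show "f x \<in> U" using R(2)[OF that] x unfolding U_def by blast
    qed
    show "\<exists>r\<in>{-1<..<1} - {0}. \<exists>t. \<forall>x\<in>C. f x = r * x + t"
      if f: "f \<in> set fs" and C: "C \<in> components U" for f C
    proof (rule cpl_contraction_affine_on[OF cpl[OF f] in_components_connected[OF C]
          in_components_nonempty[OF C]])
      have "C \<subseteq> U" by (rule in_components_subset[OF C])
      then show "C \<inter> breaking_points f = {}"
        using preorbit.base[of _ "{-R<..<R}" B] f unfolding U_def Q_def B_def by blast
    qed
    show "\<Lambda> \<subseteq> closure (\<Lambda> \<inter> U)"
    proof
      fix x assume x: "x \<in> \<Lambda>"
      show "x \<in> closure (\<Lambda> \<inter> U)"
      proof (cases "x \<in> Q")
        case True
        then have "x islimpt \<Lambda>"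
          using preorbit_limit_point[OF per] x False unfolding Q_def by blast
        moreover have "\<Lambda> = (Q \<inter> \<Lambda>) \<union> (\<Lambda> \<inter> U)" using R(1) by (auto simp: U_def)
        ultimately have "x islimpt (\<Lambda> \<inter> U)"
          using islimpt_Un_finite[of "Q \<inter> \<Lambda>" x "\<Lambda> \<inter> U"] finQ by simp
        then show ?thesis by (simp add: closure_def)
      next
        case False
        then have "x \<in> \<Lambda> \<inter> U" using x R(1) by (auto simp: U_def)
        then show ?thesis by (rule closure_subset[THEN subsetD])
      qed
    qed
  qed
qed

end
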